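(* Let $0<\alpha<1$, let $a<b$ be real numbers with $a\equiv b\pmod 1$, and let $f,g$ be real-valued functions defined on $\mathbb{N}_a\cap{}_{b}\mathbb{N}$. Then $$\sum_{s=a+1}^{b-1}g(s)\,{}^{C}\nabla_a^\alpha f(s)=f(s)\,{}_{b}\nabla^{-(1-\alpha)}g(s)\Big|_{a}^{b-1}+\sum_{s=a}^{b-2}f(s)\,{}_{b}\nabla^\alpha g(s),$$ where ${}_{b}\nabla^{-(1-\alpha)}g(b-1)=g(b-1)$.
   Context: Notation: $\mathbb{N}_a=\{a,a+1,\dots\}$, ${}_{b}\mathbb{N}=\{b,b-1,\dots\}$; $\Delta f(t)=f(t+1)-f(t)$, $\nabla f(t)=f(t)-f(t-1)$; $\rho(t)=t-1$; $F(s)\big|_{a}^{b-1}=F(b-1)-F(a)$; empty sums are $0$. Rising function: $t^{\overline{\beta}}=\Gamma(t+\beta)/\Gamma(t)$. For $0<\alpha<1$: the nabla left Caputo fractional difference is ${}^{C}\nabla_a^\alpha f(t)=\frac{1}{\Gamma(1-\alpha)}\sum_{s=a+1}^{t}(t-\rho(s))^{\overline{-\alpha}}\nabla f(s)$, $t\in\mathbb{N}_{a+1}$. The nabla right fractional sum of order $1-\alpha$ is ${}_{b}\nabla^{-(1-\alpha)}g(t)=\frac{1}{\Gamma(1-\alpha)}\sum_{s=t}^{b-1}(s-\rho(t))^{\overline{-\alpha}}g(s)$, $t\in{}_{b-1}\mathbb{N}$. The nabla right (Riemann) fractional difference is ${}_{b}\nabla^\alpha g(t)=-\Delta\big({}_{b}\nabla^{-(1-\alpha)}g\big)(t)$.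 *)

theory Defs
  imports "HOL-Analysis.Analysis" "HOL-Library.Real_Mod"
begin

definition nats_up :: "real \<Rightarrow> real set" where
  "nats_up a = {a + real n | n. True}"

definition nats_down :: "real \<Rightarrow> real set" where
  "nats_down b = {b - real n | n. True}"

text \<open>
  All sums run over \<open>grid a b = {a, a + 1, \<dots>, b}\<close>. It is empty if \<open>b < a\<close>, so that
  empty sums are \<open>0\<close>. Functions on a grid are modelled as total functions on the reals; only
  their values at points of the grid enter.
\<close>

definition grid :: "real \<Rightarrow> real \<Rightarrow> real set" where
  "grid a b = nats_up a \<inter> nats_down b"

lemma grid_add_of_nat: "grid a (a + real n) = (\<lambda>k. a + real k) ` {0..n}"
proof (intro equalityI subsetI)
  fix x assume "x \<in> grid a (a + real n)"
  then obtain k m where "x = a + real k" "x = a + real n - real m"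
    unfolding grid_def nats_up_def nats_down_def by blast
  then show "x \<in> (\<lambda>k. a + real k) ` {0..n}" by auto
next
  fix x assume "x \<in> (\<lambda>k. a + real k) ` {0..n}"
  then obtain k where k: "k \<le> n" "x = a + real k" by auto
  then have "x = a + real n - real (n - k)" by (simp add: of_nat_diff)
  then show "x \<in> grid a (a + real n)"
    unfolding grid_def nats_up_def nats_down_def using k by blast
qed

lemma grid_empty: "b < a \<Longrightarrow> grid a b = {}"
  by (auto simp: grid_def nats_up_def nats_down_def)

lemma finite_grid [simp, intro]: "finite (grid a b)"
proof (cases "grid a b = {}")
  case False
  then obtain k m where "a + real k = b - real m"
    unfolding grid_def nats_up_def nats_down_def by blast
  then have "b = a + real (k + m)" by simp
  then show ?thesis by (simp only: grid_add_of_nat) simp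
qed simp

definition Delta :: "(real \<Rightarrow> real) \<Rightarrow> real \<Rightarrow> real" where
  "Delta f t = f (t + 1) - f t"

definition nabla :: "(real \<Rightarrow> real) \<Rightarrow> real \<Rightarrow> real" where
  "nabla f t = f t - f (t - 1)"

definition rho :: "real \<Rightarrow> real" where
  "rho t = t - 1"

definition rising :: "real \<Rightarrow> real \<Rightarrow> real" where
  "rising t \<beta> = Gamma (t + \<beta>) / Gamma t"

text \<open>
  The left Caputo difference of order \<open>0 < \<alpha> < 1\<close>, meant for \<open>t \<in> nats_up (a + 1)\<close>.
\<close>

definition caputo_left :: "real \<Rightarrow> real \<Rightarrow> (real \<Rightarrow> real) \<Rightarrow> real \<Rightarrow> real" where
  "caputo_left a \<alpha> f t =
     1 / Gamma (1 - \<alpha>) * (\<Sum>s\<in>grid (a + 1) t. rising (t - rho s) (- \<alpha>) * nabla f s)"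

text \<open>
  The right fractional sum of order \<open>\<nu> > 0\<close>, meant for \<open>t \<in> nats_down (b - 1)\<close>; for
  \<open>\<nu> = 1 - \<alpha>\<close> the exponent \<open>\<nu> - 1\<close> is \<open>- \<alpha>\<close>.
\<close>

definition right_sum :: "real \<Rightarrow> real \<Rightarrow> (real \<Rightarrow> real) \<Rightarrow> real \<Rightarrow> real" where
  "right_sum b \<nu> g t =
     1 / Gamma \<nu> * (\<Sum>s\<in>grid t (b - 1). rising (s - rho t) (\<nu> - 1) * g s)"

definition right_diff :: "real \<Rightarrow> real \<Rightarrow> (real \<Rightarrow> real) \<Rightarrow> real \<Rightarrow> real" where
  "right_diff b \<alpha> g t = - Delta (right_sum b (1 - \<alpha>) g) t"

end

theory Submission
  imports Defs
begin

text \<open>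
  The left Caputo difference convolves \<open>\<nabla>f\<close> with the same kernel by which the right fractional
  sum convolves \<open>g\<close>, and the two sums run along the rows and the columns of one
  triangle \<open>a + 1 \<le> r \<le> s \<le> b - 1\<close>. Exchanging the order of summation (\<open>sum_grid_triangle_swap\<close>)
  therefore moves the kernel from \<open>f\<close> to \<open>g\<close>: writing \<open>S\<close> for the right fractional sum of \<open>g\<close>
  of order \<open>1 - \<alpha>\<close>, the left-hand side becomes \<open>\<Sum>r. \<nabla>f(r) S(r)\<close>, taken over \<open>a + 1, \<dots>, b - 1\<close>
  (\<open>sum_mult_caputo_left\<close>). Ordinary summation by parts (\<open>summation_by_parts_grid\<close>) moves the
  difference from \<open>f\<close> to \<open>S\<close>, and \<open>- \<Delta>S\<close> is the right fractional difference of \<open>g\<close>.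
  The value \<open>S(b - 1) = g(b - 1)\<close> comes from the factor \<open>1 / Gamma (1 - \<alpha>)\<close>, which cancels the
  kernel at distance \<open>0\<close> (\<open>right_sum_last\<close>).
\<close>

text \<open>
  The upper end \<open>c + n - 1\<close> lets \<open>n = 0\<close> cover the empty grid, which occurs when \<open>b = a + 1\<close>.
\<close>

lemma sum_grid:
  "(\<Sum>s\<in>grid c (c + real n - 1). h s) = (\<Sum>k<n. h (c + real k))"
proof (cases n)
  case 0
  then show ?thesis by (simp add: grid_empty)
next
  case (Suc m)
  have "grid c (c + real n - 1) = (\<lambda>k. c + real k) ` {..<n}"
    using grid_add_of_nat[of c m] by (auto simp: Suc lessThan_Suc_atMost atMost_atLeast0)
  then show ?thesis by (simp add: sum.reindex inj_on_def)
qed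

lemma grid_singleton: "grid c c = {c}"
  using grid_add_of_nat[of c 0] by simp

text \<open>
  Trading the two natural-number witnesses for order and integrality makes inclusions between
  grids a matter of linear order and closure of \<open>\<int>\<close> under subtraction.
\<close>

lemma mem_grid_iff:
  "s \<in> grid c d \<longleftrightarrow> c \<le> s \<and> s \<le> d \<and> s - c \<in> \<int> \<and> d - s \<in> \<int>"
proof -
  have nat_iff: "(\<exists>n. x = real n) \<longleftrightarrow> 0 \<le> x \<and> x \<in> \<int>" for x :: real
    using Nats_altdef2[where 'a = real] by (auto elim!: Nats_cases)
  have "s \<in> grid c d \<longleftrightarrow> (\<exists>n. s - c = real n) \<and> (\<exists>n. d - s = real n)"
    by (auto simp: grid_def nats_up_def nats_down_def algebra_simps)
  then show ?thesis unfolding nat_iff by auto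
qed

lemma grid_initial_segment:
  assumes "s \<in> grid c d"
  shows "grid c s = {r \<in> grid c d. r \<le> s}"
proof -
  have "d - r \<in> \<int> \<longleftrightarrow> s - r \<in> \<int>" for r
    using Ints_add[of "d - s" "s - r"] Ints_diff[of "d - r" "d - s"] assms
    by (auto simp: mem_grid_iff)
  then show ?thesis using assms by (auto simp: mem_grid_iff)
qed

lemma grid_final_segment:
  assumes "r \<in> grid c d"
  shows "grid r d = {s \<in> grid c d. r \<le> s}"
proof -
  have "s - c \<in> \<int> \<longleftrightarrow> s - r \<in> \<int>" for s
    using Ints_add[of "s - r" "r - c"] Ints_diff[of "s - c" "r - c"] assms
    by (auto simp: mem_grid_iff)
  then show ?thesis using assms by (auto simp: mem_grid_iff)
qed

text \<open>
  Both iterated sums run over the triangle of pairs \<open>r \<le> s\<close> in \<open>grid c d\<close>.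
\<close>

lemma sum_grid_triangle_swap:
  "(\<Sum>s\<in>grid c d. \<Sum>r\<in>grid c s. h s r) = (\<Sum>r\<in>grid c d. \<Sum>s\<in>grid r d. h s r)"
proof -
  have "(\<Sum>s\<in>grid c d. \<Sum>r\<in>grid c s. h s r)
      = (\<Sum>s\<in>grid c d. \<Sum>r\<in>{r \<in> grid c d. r \<le> s}. h s r)"
    by (simp add: grid_initial_segment)
  also have "\<dots> = (\<Sum>r\<in>grid c d. \<Sum>s\<in>{s \<in> grid c d. r \<le> s}. h s r)"
    by (rule sum.swap_restrict) auto
  also have "\<dots> = (\<Sum>r\<in>grid c d. \<Sum>s\<in>grid r d. h s r)"
    by (simp add: grid_final_segment)
  finally show ?thesis .
qed

text \<open>
  The Caputo difference and the right fractional sum are adjoint up to \<open>\<nabla>\<close>: at a pair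
  \<open>r \<le> s\<close> both carry the weight \<open>rising (s - rho r) (- \<alpha>)\<close>.
\<close>

lemma sum_mult_caputo_left:
  "(\<Sum>s\<in>grid (a + 1) (b - 1). g s * caputo_left a \<alpha> f s)
     = (\<Sum>r\<in>grid (a + 1) (b - 1). nabla f r * right_sum b (1 - \<alpha>) g r)"
proof -
  define w where
    "w s r = 1 / Gamma (1 - \<alpha>) * rising (s - rho r) (- \<alpha>) * nabla f r * g s" for s r
  have "(\<Sum>s\<in>grid (a + 1) (b - 1). g s * caputo_left a \<alpha> f s)
      = (\<Sum>s\<in>grid (a + 1) (b - 1). \<Sum>r\<in>grid (a + 1) s. w s r)"
    by (simp add: caputo_left_def w_def sum_distrib_left mult_ac)
  also have "\<dots> = (\<Sum>r\<in>grid (a + 1) (b - 1). \<Sum>s\<in>grid r (b - 1). w s r)"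
    by (rule sum_grid_triangle_swap)
  also have "\<dots> = (\<Sum>r\<in>grid (a + 1) (b - 1). nabla f r * right_sum b (1 - \<alpha>) g r)"
    by (simp add: right_sum_def w_def sum_distrib_left mult_ac)
  finally show ?thesis .
qed

lemma summation_by_parts_grid:
  "(\<Sum>r\<in>grid (a + 1) (a + real n). nabla f r * S r)
     = f (a + real n) * S (a + real n) - f a * S a
       - (\<Sum>s\<in>grid a (a + real n - 1). f s * Delta S s)"
proof -
  have shift: "a + real n = (a + 1) + real n - 1" by simp
  have "(\<Sum>r\<in>grid (a + 1) (a + real n). nabla f r * S r)
      = (\<Sum>k<n. nabla f (a + 1 + real k) * S (a + 1 + real k))"
    unfolding shift by (rule sum_grid)
  also have "\<dots> = f (a + real n) * S (a + real n) - f a * S a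
      - (\<Sum>k<n. f (a + real k) * Delta S (a + real k))"
    by (induction n) (simp_all add: nabla_def Delta_def algebra_simps)
  finally show ?thesis by (simp add: sum_grid)
qed

text \<open>
  The sum has the single term \<open>s = t\<close>, whose weight is \<open>Gamma \<nu> / Gamma 1 = Gamma \<nu>\<close>.
\<close>

lemma right_sum_last:
  assumes "0 < \<nu>"
  shows "right_sum b \<nu> g (b - 1) = g (b - 1)"
  using Gamma_real_pos[OF assms]
  by (simp add: right_sum_def grid_singleton rho_def rising_def)

theorem theorem6p7:
  fixes \<alpha> a b :: real and f g :: "real \<Rightarrow> real"
  assumes "0 < \<alpha>" and "\<alpha> < 1"
    and "a < b" and "[a = b] (rmod 1)"
  shows "(\<Sum>s\<in>grid (a + 1) (b - 1). g s * caputo_left a \<alpha> f s) =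
           (f (b - 1) * right_sum b (1 - \<alpha>) g (b - 1) - f a * right_sum b (1 - \<alpha>) g a)
           + (\<Sum>s\<in>grid a (b - 2). f s * right_diff b \<alpha> g s)
         \<and> right_sum b (1 - \<alpha>) g (b - 1) = g (b - 1)"
proof
  obtain k :: int where k: "b = a + of_int k"
    using assms(4) by (auto simp: rcong_altdef)
  have "k \<ge> 1" using k assms(3) by simp
  then have n: "b - 1 = a + real (nat (k - 1))" using k by simp
  define S where "S = right_sum b (1 - \<alpha>) g"
  have "(\<Sum>s\<in>grid (a + 1) (b - 1). g s * caputo_left a \<alpha> f s)
      = (\<Sum>r\<in>grid (a + 1) (b - 1). nabla f r * S r)"
    unfolding S_def by (rule sum_mult_caputo_left)
  also have "\<dots> = f (b - 1) * S (b - 1) - f a * S a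
      - (\<Sum>s\<in>grid a (b - 1 - 1). f s * Delta S s)"
    unfolding n by (rule summation_by_parts_grid)
  also have "\<dots> = f (b - 1) * S (b - 1) - f a * S a
      + (\<Sum>s\<in>grid a (b - 2). f s * right_diff b \<alpha> g s)"
    by (simp add: right_diff_def S_def sum_negf)
  finally show "(\<Sum>s\<in>grid (a + 1) (b - 1). g s * caputo_left a \<alpha> f s) =
      (f (b - 1) * right_sum b (1 - \<alpha>) g (b - 1) - f a * right_sum b (1 - \<alpha>) g a)
      + (\<Sum>s\<in>grid a (b - 2). f s * right_diff b \<alpha> g s)"
    unfolding S_def .
  show "right_sum b (1 - \<alpha>) g (b - 1) = g (b - 1)"
    using assms(2) by (intro right_sum_last) simp
qed

end
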